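(* Let $d\geq 1$ and $r\geq 3$ be integers with $2r-2\geq d$. Then the topological Tverberg number of the matroid $M_r$ satisfies $\mathrm{TT}(M_r,d)\geq 2$; that is, for every continuous map $f\colon |M_r|\to\mathbb{R}^d$ there exist two disjoint faces $\sigma_1,\sigma_2$ of $M_r$ with $f(\sigma_1)\cap f(\sigma_2)\neq\emptyset$.
   Context: The matroid $M_r$ ($r\ge 2$): let $E$ consist of pairwise distinct elements $v_i^j$ ($i=1,\dots,r-1$, $j=1,\dots,r$) and $w_1,\dots,w_r$; set blocks $E_i=\{v_i^1,\dots,v_i^r\}$ for $i=1,\dots,r-1$ and $E_r=\{w_1,\dots,w_r\}$. Then $M_r$ is the simplicial complex on $E$ whose faces are the subsets $I\subseteq E$ with $|I|\le r$ and $|I\cap E_i|\le 1$ for $i=1,\dots,r-1$; $|M_r|$ denotes its geometric realization. For a simplicial complex $\Sigma$ and $d\ge 1$, the topological Tverberg number $\mathrm{TT}(\Sigma,d)$ is the largest integer $k\ge1$ such that every continuous map $f\colon|\Sigma|\to\mathbb{R}^d$ admits $k$ pairwise disjoint faces $\sigma_1,\dots,\sigma_k$ of $\Sigma$ with $\bigcap_{i=1}^k f(\sigma_i)\neq\emptyset$. *)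

theory Defs
  imports "HOL-Analysis.Analysis"
begin

text \<open>
  An abstract simplicial complex on vertices of type \<open>'v\<close> is given by its set of faces, the empty
  face included. Points of its geometric realization are given by barycentric coordinates.
\<close>

definition face_realization :: "'v set \<Rightarrow> ('v \<Rightarrow> real) set" where
  "face_realization \<sigma> =
     {x. (\<forall>u. 0 \<le> x u) \<and> (\<forall>u. u \<notin> \<sigma> \<longrightarrow> x u = 0) \<and> (\<Sum>u\<in>\<sigma>. x u) = 1}"

definition realization :: "'v set set \<Rightarrow> ('v \<Rightarrow> real) set" where
  "realization \<Sigma> = (\<Union>\<sigma>\<in>\<Sigma>. face_realization \<sigma>)"

text \<open>
  All complexes are meant to be finite. The subspace topology below is then the usual topology of
  the geometric realization (for infinite complexes the latter can be strictly finer).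
\<close>

definition realization_topology :: "'v set set \<Rightarrow> ('v \<Rightarrow> real) topology" where
  "realization_topology \<Sigma> = subtopology (powertop_real UNIV) (realization \<Sigma>)"

definition has_tverberg_property :: "'v set set \<Rightarrow> nat \<Rightarrow> nat \<Rightarrow> bool" where
  "has_tverberg_property \<Sigma> d k \<longleftrightarrow>
     (\<forall>f. continuous_map (realization_topology \<Sigma>) (Euclidean_space d) f \<longrightarrow>
        (\<exists>\<sigma> :: nat \<Rightarrow> 'v set.
           (\<forall>i\<in>{1..k}. \<sigma> i \<in> \<Sigma>) \<and>
           (\<forall>i\<in>{1..k}. \<forall>j\<in>{1..k}. i \<noteq> j \<longrightarrow> \<sigma> i \<inter> \<sigma> j = {}) \<and>
           (\<Inter>i\<in>{1..k}. f ` face_realization (\<sigma> i)) \<noteq> {}))"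

text \<open>
  The empty face has empty realization, so the faces above are automatically nonempty when
  \<open>k \<ge> 1\<close>. Hence, for a finite complex with at least one vertex, \<open>k = 1\<close> is admissible and all
  admissible \<open>k\<close> are bounded by the number of vertices, so that the maximum exists.
\<close>

definition TT :: "'v set set \<Rightarrow> nat \<Rightarrow> nat" where
  "TT \<Sigma> d = (GREATEST k. k \<ge> 1 \<and> has_tverberg_property \<Sigma> d k)"

text \<open>\<open>V i j\<close> stands for $v_i^j$ and \<open>W j\<close> for $w_j$.\<close>

datatype vertex = V nat nat | W nat

definition block :: "nat \<Rightarrow> nat \<Rightarrow> vertex set" where
  "block r i = (if i = r then W ` {1..r} else V i ` {1..r})"

definition ground :: "nat \<Rightarrow> vertex set" where
  "ground r = (\<Union>i\<in>{1..r}. block r i)"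

definition M :: "nat \<Rightarrow> vertex set set" where
  "M r = {I. I \<subseteq> ground r \<and> card I \<le> r \<and> (\<forall>i\<in>{1..r - 1}. card (I \<inter> block r i) \<le> 1)}"

end

theory Submission
  imports Defs "HOL-Homology.Homology"
begin

text \<open>
  Choosing three vertices in each block exhibits the join of \<open>r\<close> three-point sets inside
  \<open>M\<^sub>r\<close>. Its deleted join is the join of \<open>r\<close> hexagons, a sphere of dimension \<open>2r - 1\<close> with a free
  involution, so the Borsuk--Ulam theorem yields two points in disjoint faces with the same
  image, as in the theorem of van Kampen and Flores.

  For Borsuk--Ulam, the vanishing of the homology of the sphere \<open>S\<^sup>m\<close> below dimension \<open>m\<close> gives
  singular chains \<open>c\<^sub>0, \<dots>, c\<^sub>m\<close>, starting with a point, such that \<open>\<partial>c\<^sub>k\<^sub>+\<^sub>1 = Tc\<^sub>k \<plusminus> c\<^sub>k\<close> for the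
  antipodal map \<open>T\<close>. They may be subdivided until all simplices are small. An odd map to
  \<open>\<real>\<^sup>m\<close> without zeros labels points by \<open>\<plusminus>1, \<dots>, \<plusminus>m\<close> (a dominant coordinate and its sign) such
  that no small simplex has complementary labels. Following Ky Fan, the number of simplices of
  \<open>c\<^sub>k\<close> whose labels alternate in sign is odd for every \<open>k\<close>, yet it is zero for \<open>k = m\<close>, since
  \<open>m + 1\<close> different absolute values would be needed.
\<close>

subsection \<open>Alternating sets of labels\<close>

text \<open>
  The signs alternate along the ordering by absolute value, and \<open>b\<close> says whether the element of
  largest absolute value is positive.
\<close>

inductive alternating :: "bool \<Rightarrow> int set \<Rightarrow> bool" where
  empty: "alternating b {}"
| insert: "alternating (\<not> b) L \<Longrightarrow> \<forall>y\<in>L. \<bar>y\<bar> < \<bar>x\<bar> \<Longrightarrow> x > 0 \<longleftrightarrow> b \<Longrightarrow> alternating b (insert x L)"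

declare alternating.empty [simp]

lemma alternating_insert_iff:
  assumes "\<forall>y\<in>L. \<bar>y\<bar> < \<bar>x\<bar>"
  shows "alternating b (insert x L) \<longleftrightarrow> alternating (\<not> b) L \<and> (x > 0 \<longleftrightarrow> b)"
proof
  assume "alternating b (insert x L)"
  then show "alternating (\<not> b) L \<and> (x > 0 \<longleftrightarrow> b)"
  proof cases
    case (insert L' x')
    have "x = x'"
      using insert assms by (metis insert_iff less_asym)
    then have "L = L'"
      using insert assms by (metis insert_ident less_irrefl)
    then show ?thesis
      using insert \<open>x = x'\<close> by simp
  qed auto
qed (use assms in \<open>auto intro: alternating.insert\<close>)

lemma alternating_uminus:
  assumes "alternating b L" "0 \<notin> L"
  shows "alternating (\<not> b) (uminus ` L)"
  using assms
proof induction
  case (insert b L x)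
  then have "alternating b (uminus ` L)" "x \<noteq> 0"
    by auto
  then have "alternating (\<not> b) (insert (- x) (uminus ` L))"
    using insert by (intro alternating.insert) auto
  then show ?case by simp
qed simp

lemma alternating_uminus_iff:
  assumes "0 \<notin> L"
  shows "alternating b (uminus ` L) \<longleftrightarrow> alternating (\<not> b) L"
proof
  assume "alternating b (uminus ` L)"
  then have "alternating (\<not> b) (uminus ` uminus ` L)"
    using assms by (intro alternating_uminus) auto
  then show "alternating (\<not> b) L"
    by (simp add: image_image)
qed (use assms alternating_uminus[of "\<not> b" L] in auto)

text \<open>The local parity step of Fan's argument. Induction adds the element \<open>x\<close> of
  largest absolute value: removing \<open>x\<close> leaves \<open>L\<close>, while removing any
  other element keeps \<open>x\<close> on top, which fixes the sign of \<open>x\<close> and flips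
  \<open>b\<close> for the rest. The hypothesis excludes 0 (take \<open>y = x\<close>) and ties of
  absolute values.\<close>

lemma even_card_alternating_remove:
  fixes L :: "int set"
  assumes "finite L" "\<And>x y. x \<in> L \<Longrightarrow> y \<in> L \<Longrightarrow> x \<noteq> - y"
  shows "even (int (card {x \<in> L. alternating b (L - {x})})
               - (of_bool (alternating b L) + of_bool (alternating (\<not> b) L)))"
  using assms
proof (induction arbitrary: b rule: finite_ranking_induct[where f = abs])
  case empty
  then show ?case by simp
next
  case (insert x L)
  show ?case
  proof (cases "x \<in> L")
    case True
    then show ?thesis using insert by (simp add: insert_absorb)
  next
    case False
    have dom: "\<bar>y\<bar> < \<bar>x\<bar>" if "y \<in> L" for y
    proof -
      have "\<bar>y\<bar> \<noteq> \<bar>x\<bar>"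
        using that False insert.prems[of x y] by (auto simp: abs_eq_iff)
      then show ?thesis
        using insert.hyps(2)[OF that] by simp
    qed
    have remove: "alternating b (insert x L - {y}) \<longleftrightarrow>
        alternating (\<not> b) (L - {y}) \<and> (x > 0 \<longleftrightarrow> b)" if "y \<in> L" for y
    proof -
      have "insert x L - {y} = insert x (L - {y})"
        using that False by auto
      then show ?thesis
        using dom by (simp add: alternating_insert_iff)
    qed
    have "{y \<in> insert x L. alternating b (insert x L - {y})} =
          (if alternating b L then {x} else {}) \<union>
          (if x > 0 \<longleftrightarrow> b then {y \<in> L. alternating (\<not> b) (L - {y})} else {})"
      using remove False by auto
    then have "int (card {y \<in> insert x L. alternating b (insert x L - {y})}) =
        of_bool (alternating b L) +
        (if x > 0 \<longleftrightarrow> b then int (card {y \<in> L. alternating (\<not> b) (L - {y})}) else 0)"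
      using insert.hyps(1) False by (simp add: card_Un_disjoint)
    moreover have "alternating b (insert x L) \<longleftrightarrow> alternating (\<not> b) L \<and> (x > 0 \<longleftrightarrow> b)" for b
      using dom by (simp add: alternating_insert_iff)
    moreover have "even (int (card {y \<in> L. alternating (\<not> b) (L - {y})})
        - (of_bool (alternating (\<not> b) L) + of_bool (alternating (\<not> \<not> b) L)))"
      using insert.prems by (intro insert.IH) auto
    ultimately show ?thesis
      by auto
  qed
qed

text \<open>For the labels of \<open>n\<close> vertices, the cardinality condition forces them to be
  distinct, so simplices with repeated labels are not counted.\<close>

definition alternating_labels :: "bool \<Rightarrow> nat \<Rightarrow> int set \<Rightarrow> bool" where
  "alternating_labels b n L \<longleftrightarrow> alternating b L \<and> card L = n"

text \<open>For distinct labels, faces correspond to removals of single labels. If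
  \<open>l i = l j\<close>, only the faces omitting \<open>i\<close> or \<open>j\<close> can have
  \<open>p\<close> distinct labels, and these two have the same label set, so the count is 0 or
  2.\<close>

lemma even_card_alternating_faces:
  fixes l :: "nat \<Rightarrow> int"
  assumes "\<And>i j. i \<le> p \<Longrightarrow> j \<le> p \<Longrightarrow> l i \<noteq> - l j"
  shows "even (int (card {k. k \<le> p \<and> alternating_labels True p (l ` ({..p} - {k}))})
    - (of_bool (alternating_labels True (Suc p) (l ` {..p}))
       + of_bool (alternating_labels False (Suc p) (l ` {..p}))))"
proof (cases "inj_on l {..p}")
  case True
  let ?L = "l ` {..p}"
  have card_L: "card ?L = Suc p"
    using True by (simp add: card_image)
  have face: "l ` ({..p} - {k}) = ?L - {l k}" if "k \<le> p" for k
    using that inj_on_image_set_diff[OF True, of "{..p}" "{k}"] by simp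
  have "bij_betw l {k. k \<le> p \<and> alternating_labels True p (l ` ({..p} - {k}))}
          {x \<in> ?L. alternating True (?L - {x})}"
    unfolding bij_betw_def
  proof
    show "inj_on l {k. k \<le> p \<and> alternating_labels True p (l ` ({..p} - {k}))}"
      using True by (rule inj_on_subset) auto
    show "l ` {k. k \<le> p \<and> alternating_labels True p (l ` ({..p} - {k}))} =
            {x \<in> ?L. alternating True (?L - {x})}"
      by (auto simp: alternating_labels_def face card_L)
  qed
  then have "card {k. k \<le> p \<and> alternating_labels True p (l ` ({..p} - {k}))} =
      card {x \<in> ?L. alternating True (?L - {x})}"
    by (rule bij_betw_same_card)
  moreover have "even (int (card {x \<in> ?L. alternating True (?L - {x})})
        - (of_bool (alternating True ?L) + of_bool (alternating (\<not> True) ?L)))"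
    using assms by (intro even_card_alternating_remove) auto
  ultimately show ?thesis
    by (simp add: alternating_labels_def card_L)
next
  case False
  then obtain i j where ij: "i \<le> p" "j \<le> p" "i \<noteq> j" "l i = l j"
    by (auto simp: inj_on_def)
  have "card (l ` {..p}) \<noteq> Suc p"
    using False eq_card_imp_inj_on[of "{..p}" l] by auto
  moreover have "l ` ({..p} - {x}) = l ` {..p}" if "x \<in> {i, j}" for x
  proof -
    obtain y where "y \<in> {..p} - {x}" "l x = l y"
      using \<open>x \<in> {i, j}\<close> ij by auto
    then show ?thesis
      by (auto intro: rev_image_eqI)
  qed
  moreover have "card (l ` ({..p} - {k})) \<noteq> p" if "k \<le> p" "k \<noteq> i" "k \<noteq> j" for k
  proof
    assume "card (l ` ({..p} - {k})) = p"
    then have "inj_on l ({..p} - {k})"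
      using that by (intro eq_card_imp_inj_on) auto
    then show False
      using ij that by (auto simp: inj_on_def)
  qed
  ultimately have "k \<le> p \<and> alternating_labels True p (l ` ({..p} - {k})) \<longleftrightarrow>
      k \<in> {i, j} \<and> alternating_labels True p (l ` {..p})" for k
    using ij by (cases "k \<in> {i, j}") (auto simp: alternating_labels_def)
  then have "{k. k \<le> p \<and> alternating_labels True p (l ` ({..p} - {k}))} =
      (if alternating_labels True p (l ` {..p}) then {i, j} else {})"
    by auto
  then show ?thesis
    using \<open>card (l ` {..p}) \<noteq> Suc p\<close> \<open>i \<noteq> j\<close> by (simp add: alternating_labels_def)
qed

subsection \<open>Small antipodal chains on spheres\<close>

text \<open>Reduced homology of \<open>nsphere m\<close> vanishes below degree \<open>m\<close>. In
  degree 0 the extra hypothesis, that the image over a point is zero, puts the class in the kernel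
  defining reduced homology.\<close>

lemma nsphere_cycle_is_boundary:
  assumes "p < m" "singular_relcycle p (nsphere m) {} c"
    and "p = 0 \<Longrightarrow> chain_map 0 (\<lambda>x. ()) c = 0"
  obtains d where "singular_chain (Suc p) (nsphere m) d" "chain_boundary (Suc p) d = c"
proof -
  let ?c = "homologous_rel_set p (nsphere m) {} c"
  have carrier: "?c \<in> carrier (homology_group p (nsphere m))"
    using assms(2) by (simp add: carrier_relative_homology_group)
  have "?c \<in> carrier (reduced_homology_group p (nsphere m))"
  proof (cases "p = 0")
    case True
    have "hom_induced p (nsphere m) {} (discrete_topology {()}) {} (\<lambda>x. ()) ?c =
          homologous_rel_set p (discrete_topology {()}) {} (chain_map p (\<lambda>x. ()) c)"
      using assms(2) by (intro hom_induced_chain_map) auto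
    also have "\<dots> = \<one>\<^bsub>homology_group p (discrete_topology {()})\<^esub>"
      using True assms(3) homologous_rel_set_eq_relboundary[of p _ "{}" 0]
        one_relative_homology_group[of p "discrete_topology {()}" "{}"] by simp
    finally show ?thesis
      using carrier unfolding carrier_reduced_homology_group by (simp add: kernel_def)
  qed (use carrier in \<open>simp add: un_reduced_homology_group\<close>)
  moreover have "trivial_group (reduced_homology_group p (nsphere m))"
    using assms(1) by (simp add: trivial_reduced_homology_group_nsphere)
  ultimately have "?c = \<one>\<^bsub>homology_group p (nsphere m)\<^esub>"
    by (simp add: trivial_group_def one_reduced_homology_group)
  then have "singular_relboundary p (nsphere m) {} c"
    using homologous_rel_set_eq_relboundary[of p "nsphere m" "{}" c] by simp
  then show ?thesis
    using that by (auto simp: singular_boundary)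
qed

definition antipode :: "(nat \<Rightarrow> real) \<Rightarrow> nat \<Rightarrow> real" where
  "antipode x = (\<lambda>i. - x i)"

lemma antipode_antipode [simp]: "antipode (antipode x) = x"
  by (simp add: antipode_def)

lemma continuous_map_antipode: "continuous_map (nsphere m) (nsphere m) antipode"
  unfolding nsphere continuous_map_in_subtopology antipode_def
  by (auto simp: continuous_map_componentwise_UNIV intro!: continuous_intros
      continuous_map_from_subtopology continuous_map_product_projection)

lemma antipode_in_nsphere [simp]:
  "x \<in> topspace (nsphere m) \<Longrightarrow> antipode x \<in> topspace (nsphere m)"
  by (simp add: nsphere antipode_def)

lemma chain_map_antipode_antipode:
  assumes "singular_chain p (nsphere m) c"
  shows "chain_map p antipode (chain_map p antipode c) = c"
proof -
  have "chain_map p (antipode \<circ> antipode) c = c"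
    by (rule chain_map_id_gen[OF assms]) simp
  then show ?thesis
    by (simp add: chain_map_compose)
qed

text \<open>The first unit vector, which lies on every \<open>nsphere m\<close>. The restricted
  abstraction is there because singular simplices are extensional on the standard simplex.\<close>

definition base_chain :: "(nat \<Rightarrow> real) chain" where
  "base_chain = frag_of (\<lambda>t\<in>standard_simplex 0. \<lambda>i. if i = 0 then 1 else 0)"

lemma singular_chain_base_chain: "singular_chain 0 (nsphere m) base_chain"
  unfolding base_chain_def singular_chain_of singular_simplex_def
  using in_topspace_nsphere[of m] by (simp add: continuous_map_const)

text \<open>Since the antipodal map is an involution commuting with the boundary, the alternating
  signs make the prescribed boundary a cycle, so the next chain exists. The chains act as
  hemispheres of growing dimension.\<close>

lemma antipodal_chains:
  obtains c where "c 0 = base_chain" "\<And>k. k \<le> m \<Longrightarrow> singular_chain k (nsphere m) (c k)"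
    "\<And>k. k < m \<Longrightarrow> chain_boundary (Suc k) (c (Suc k)) =
      chain_map k antipode (c k) + frag_cmul ((-1) ^ Suc k) (c k)"
proof -
  let ?S = "nsphere m" and ?T = "\<lambda>k. chain_map k antipode"
  have "\<exists>c. c 0 = base_chain \<and> (\<forall>k\<le>n. singular_chain k ?S (c k)) \<and>
    (\<forall>k<n. chain_boundary (Suc k) (c (Suc k)) = ?T k (c k) + frag_cmul ((-1) ^ Suc k) (c k))"
    if "n \<le> m" for n
    using that
  proof (induction n)
    case 0
    show ?case
      using singular_chain_base_chain by (intro exI[of _ "\<lambda>_. base_chain"]) simp
  next
    case (Suc n)
    then obtain c where c0: "c 0 = base_chain"
      and c: "\<And>k. k \<le> n \<Longrightarrow> singular_chain k ?S (c k)"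
      and bd: "\<And>k. k < n \<Longrightarrow> chain_boundary (Suc k) (c (Suc k)) =
          ?T k (c k) + frag_cmul ((-1) ^ Suc k) (c k)"
      by auto
    define z where "z = ?T n (c n) + frag_cmul ((-1) ^ Suc n) (c n)"
    have z: "singular_chain n ?S z"
      unfolding z_def using c continuous_map_antipode
      by (intro singular_chain_add singular_chain_cmul singular_chain_chain_map) auto
    have "chain_boundary n z = 0"
    proof (cases n)
      case (Suc k)
      have "chain_boundary n z = ?T k (chain_boundary n (c n)) +
          frag_cmul ((-1) ^ Suc n) (chain_boundary n (c n))"
        unfolding z_def using chain_boundary_chain_map[OF c[of n]] Suc
        by (simp add: chain_boundary_add chain_boundary_cmul)
      also have "\<dots> = ?T k (?T k (c k) + frag_cmul ((-1) ^ Suc k) (c k)) +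
          frag_cmul ((-1) ^ Suc (Suc k)) (?T k (c k) + frag_cmul ((-1) ^ Suc k) (c k))"
        using bd[of k] Suc by simp
      also have "\<dots> = 0"
        using chain_map_antipode_antipode[OF c[of k]] Suc
        by (cases "even k") (auto simp: chain_map_add chain_map_minus chain_map_diff)
      finally show ?thesis .
    qed (simp add: chain_boundary_def)
    with z have "singular_relcycle n ?S {} z"
      by (simp add: singular_cycle)
    \<comment> \<open>Antipode minus base point: the coefficients sum to zero.\<close>
    moreover have "chain_map 0 (\<lambda>x. ()) z = 0" if "n = 0"
      using that c0
      by (simp add: z_def base_chain_def chain_map_diff simplex_map_def chain_map_minus chain_map_add o_def)
    ultimately obtain d where "singular_chain (Suc n) ?S d" "chain_boundary (Suc n) d = z"
      using nsphere_cycle_is_boundary[of n m z] Suc.prems by auto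
    then show ?case
      using c0 c bd
      by (intro exI[of _ "c(Suc n := d)"]) (auto simp: z_def le_Suc_eq less_Suc_eq)
  qed
  from this[of m] show ?thesis
    using that by auto
qed

section \<open>Iterated subdivision of the antipodal chains\<close>

lemma funpow_singular_subdivision_chain:
  assumes "singular_chain p X c"
  shows "singular_chain p X ((singular_subdivision p ^^ n) c)"
  using assms by (induction n) (auto intro: singular_chain_singular_subdivision)

lemma funpow_singular_subdivision_boundary:
  assumes "singular_chain p X c"
  shows "chain_boundary p ((singular_subdivision p ^^ n) c) =
    (singular_subdivision (p - Suc 0) ^^ n) (chain_boundary p c)"
  using assms
  by (induction n)
    (auto simp: chain_boundary_singular_subdivision[OF funpow_singular_subdivision_chain])

lemma funpow_singular_subdivision_chain_map:
  assumes "singular_chain p X c"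
  shows "(singular_subdivision p ^^ n) (chain_map p g c) =
    chain_map p g ((singular_subdivision p ^^ n) c)"
  using assms
  by (induction n)
    (auto simp: naturality_singular_subdivision[OF funpow_singular_subdivision_chain])

lemma funpow_singular_subdivision_minus_one_power:
  "(singular_subdivision p ^^ n) (a + frag_cmul ((-1) ^ k) b) =
   (singular_subdivision p ^^ n) a + frag_cmul ((-1) ^ k) ((singular_subdivision p ^^ n) b)"
proof -
  have add: "(singular_subdivision p ^^ n) (a + b) =
      (singular_subdivision p ^^ n) a + (singular_subdivision p ^^ n) b" for a b
    by (induction n arbitrary: a b) (simp_all add: singular_subdivision_add)
  then show ?thesis
    using singular_subdivision_power_diff[where p = p and n = n and a = a and b = b]
    by (cases "even k") auto
qed

lemma funpow_singular_subdivision_zero: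
  "singular_chain 0 X c \<Longrightarrow> (singular_subdivision 0 ^^ n) c = c"
  by (induction n) (auto simp: singular_subdivision_zero)

text \<open>Subdivision commutes with boundaries and chain maps and fixes 0-chains, so the relations
  survive, provided all degrees are subdivided equally often; hence the maximum \<open>n\<close>
  over the finitely many degrees.\<close>

lemma small_antipodal_chains:
  assumes "\<And>U. U \<in> \<C> \<Longrightarrow> openin (nsphere m) U" "topspace (nsphere m) \<subseteq> \<Union>\<C>"
  obtains c where "c 0 = base_chain" "\<And>k. k \<le> m \<Longrightarrow> singular_chain k (nsphere m) (c k)"
    "\<And>k. k < m \<Longrightarrow> chain_boundary (Suc k) (c (Suc k)) =
      chain_map k antipode (c k) + frag_cmul ((-1) ^ Suc k) (c k)"
    "\<And>k f. k \<le> m \<Longrightarrow> f \<in> Poly_Mapping.keys (c k) \<Longrightarrow> \<exists>U\<in>\<C>. f \<in> standard_simplex k \<rightarrow> U"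
proof -
  obtain c where c: "c 0 = base_chain" "\<And>k. k \<le> m \<Longrightarrow> singular_chain k (nsphere m) (c k)"
    "\<And>k. k < m \<Longrightarrow> chain_boundary (Suc k) (c (Suc k)) =
      chain_map k antipode (c k) + frag_cmul ((-1) ^ Suc k) (c k)"
    using antipodal_chains by blast
  have "\<exists>n. \<forall>j f. n \<le> j \<longrightarrow> f \<in> Poly_Mapping.keys ((singular_subdivision k ^^ j) (c k)) \<longrightarrow>
          (\<exists>U\<in>\<C>. f \<in> standard_simplex k \<rightarrow> U)" if "k \<le> m" for k
    using sufficient_iterated_singular_subdivision_exists[OF assms c(2)[OF that]] by metis
  then obtain N where N: "\<And>k j f. k \<le> m \<Longrightarrow> N k \<le> j \<Longrightarrow>
      f \<in> Poly_Mapping.keys ((singular_subdivision k ^^ j) (c k)) \<Longrightarrow>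
      \<exists>U\<in>\<C>. f \<in> standard_simplex k \<rightarrow> U"
    by metis
  define n where "n = Max (N ` {..m})"
  have n: "N k \<le> n" if "k \<le> m" for k
    unfolding n_def using that by (intro Max_ge) auto
  show ?thesis
  proof (rule that[of "\<lambda>k. (singular_subdivision k ^^ n) (c k)"])
    show "(singular_subdivision 0 ^^ n) (c 0) = base_chain"
      using c(1) funpow_singular_subdivision_zero[OF singular_chain_base_chain] by simp
    show "chain_boundary (Suc k) ((singular_subdivision (Suc k) ^^ n) (c (Suc k))) =
        chain_map k antipode ((singular_subdivision k ^^ n) (c k)) +
        frag_cmul ((-1) ^ Suc k) ((singular_subdivision k ^^ n) (c k))" if "k < m" for k
    proof -
      have "chain_boundary (Suc k) ((singular_subdivision (Suc k) ^^ n) (c (Suc k))) =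
          (singular_subdivision k ^^ n) (chain_boundary (Suc k) (c (Suc k)))"
        using funpow_singular_subdivision_boundary[OF c(2)[of "Suc k"]] that by simp
      also have "\<dots> = (singular_subdivision k ^^ n) (chain_map k antipode (c k)) +
          frag_cmul ((-1) ^ Suc k) ((singular_subdivision k ^^ n) (c k))"
        unfolding c(3)[OF that] by (rule funpow_singular_subdivision_minus_one_power)
      finally show ?thesis
        using funpow_singular_subdivision_chain_map[OF c(2)[of k]] that by simp
    qed
  qed (use c(2) n N funpow_singular_subdivision_chain in blast)+
qed

subsection \<open>The Borsuk--Ulam theorem\<close>

text \<open>Linear extension of \<open>w\<close> to chains. \<open>frag_extend\<close> takes values
  in a free abelian group, so the integers appear as the free group on \<open>()\<close>.\<close>

definition weight :: "('a \<Rightarrow> int) \<Rightarrow> ('a \<Rightarrow>\<^sub>0 int) \<Rightarrow> int" where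
  "weight w c = Poly_Mapping.lookup (frag_extend (\<lambda>x. frag_cmul (w x) (frag_of ())) c) ()"

lemma weight_0 [simp]: "weight w 0 = 0"
  by (simp add: weight_def)

lemma weight_of [simp]: "weight w (frag_of x) = w x"
  by (simp add: weight_def)

lemma weight_cmul: "weight w (frag_cmul k c) = k * weight w c"
  by (simp add: weight_def frag_extend_cmul)

lemma weight_add: "weight w (a + b) = weight w a + weight w b"
  by (simp add: weight_def frag_extend_add lookup_add)

lemma weight_diff: "weight w (a - b) = weight w a - weight w b"
  by (simp add: weight_def frag_extend_diff lookup_minus)

lemma weight_sum: "weight w (\<Sum>i\<in>I. g i) = (\<Sum>i\<in>I. weight w (g i))"
  by (induction I rule: infinite_finite_induct) (simp_all add: weight_add)

lemma weight_eq_0: "(\<And>x. x \<in> Poly_Mapping.keys c \<Longrightarrow> w x = 0) \<Longrightarrow> weight w c = 0"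
  by (simp add: weight_def frag_extend_eq_0)

definition vertex_label :: "('a \<Rightarrow> int) \<Rightarrow> ((nat \<Rightarrow> real) \<Rightarrow> 'a) \<Rightarrow> nat \<Rightarrow> int" where
  "vertex_label lab f j = lab (f (\<lambda>i. if i = j then 1 else 0))"

definition alternating_count ::
    "bool \<Rightarrow> ('a \<Rightarrow> int) \<Rightarrow> nat \<Rightarrow> ((nat \<Rightarrow> real) \<Rightarrow> 'a) \<Rightarrow> int" where
  "alternating_count b lab p f = of_bool (alternating_labels b (Suc p) (vertex_label lab f ` {..p}))"

text \<open>The map \<open>simplical_face k\<close> shifts the vertices from \<open>k\<close> on by
  one, so \<open>k\<close> is the vertex left out.\<close>

lemma vertex_label_singular_face:
  assumes "k \<le> Suc p"
  shows "vertex_label lab (singular_face (Suc p) k f) ` {..p} = vertex_label lab f ` ({..Suc p} - {k})"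
proof -
  let ?skip = "\<lambda>j. if j < k then j else Suc j"
  have "vertex_label lab (singular_face (Suc p) k f) j = vertex_label lab f (?skip j)" if "j \<le> p" for j
  proof -
    have "simplical_face k (\<lambda>i. if i = j then 1 else 0 :: real) = (\<lambda>i. if i = ?skip j then 1 else 0)"
      by (auto simp: simplical_face_def fun_eq_iff)
    then show ?thesis
      using that by (simp add: vertex_label_def singular_face_def)
  qed
  then have "vertex_label lab (singular_face (Suc p) k f) ` {..p} = vertex_label lab f ` ?skip ` {..p}"
    unfolding image_image by (intro image_cong) auto
  moreover have "?skip ` {..p} = {..Suc p} - {k}"
  proof
    show "{..Suc p} - {k} \<subseteq> ?skip ` {..p}"
    proof
      fix j assume "j \<in> {..Suc p} - {k}"
      then have "j = ?skip (if j < k then j else j - 1)" "(if j < k then j else j - 1) \<in> {..p}"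
        using assms by auto
      then show "j \<in> ?skip ` {..p}"
        by (rule image_eqI)
    qed
  qed (use assms in auto)
  ultimately show ?thesis by simp
qed

text \<open>Modulo 2 the signs in the boundary disappear, so by linearity the count over the faces
  of a single simplex decides.\<close>

lemma even_weight_boundary:
  assumes "\<And>f i j. f \<in> Poly_Mapping.keys c \<Longrightarrow> i \<le> Suc p \<Longrightarrow> j \<le> Suc p \<Longrightarrow>
      vertex_label lab f i \<noteq> - vertex_label lab f j"
  shows "even (weight (alternating_count True lab p) (chain_boundary (Suc p) c)
    - (weight (alternating_count True lab (Suc p)) c + weight (alternating_count False lab (Suc p)) c))"
proof -
  \<comment> \<open>\<open>frag_induction\<close> takes the hypothesis as a set containing all
    generators.\<close>
  have "Poly_Mapping.keys c \<subseteq>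
      {f. \<forall>i\<le>Suc p. \<forall>j\<le>Suc p. vertex_label lab f i \<noteq> - vertex_label lab f j}"
    using assms by blast
  then show ?thesis
  proof (induction c rule: frag_induction)
    case (one f)
    let ?a = "\<lambda>k. alternating_labels True (Suc p) (vertex_label lab f ` ({..Suc p} - {k}))"
    let ?rhs = "alternating_count True lab (Suc p) f + alternating_count False lab (Suc p) f"
    have "weight (alternating_count True lab p) (chain_boundary (Suc p) (frag_of f)) =
        (\<Sum>k\<le>Suc p. (-1) ^ k * of_bool (?a k))"
      unfolding chain_boundary_of weight_sum
      by (auto simp: weight_sum weight_cmul alternating_count_def vertex_label_singular_face
          simp del: sum.atMost_Suc intro!: sum.cong)
    moreover have "even ((\<Sum>k\<le>Suc p. (-1) ^ k * of_bool (?a k)) - (\<Sum>k\<le>Suc p. of_bool (?a k)) :: int)"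
      unfolding sum_subtractf[symmetric] by (intro dvd_sum) (simp add: of_bool_def)
    moreover have "(\<Sum>k\<le>Suc p. of_bool (?a k) :: int) = int (card {k. k \<le> Suc p \<and> ?a k})"
      by (simp add: sum_of_bool_eq Int_def del: sum.atMost_Suc)
    moreover have "even (int (card {k. k \<le> Suc p \<and> ?a k}) - ?rhs)"
      using one even_card_alternating_faces[of "Suc p" "vertex_label lab f"]
      by (simp add: alternating_count_def)
    ultimately show ?case
      by (simp del: sum.atMost_Suc) 
  next
    case (diff a b)
    then show ?case
      unfolding chain_boundary_diff weight_diff by auto
  qed simp
qed

text \<open>The antipodal map negates all labels, which preserves alternation and reverses the sign
  on top.\<close>

lemma weight_chain_map_antipode:
  assumes "singular_chain p (nsphere m) c"
    and "\<And>x. x \<in> topspace (nsphere m) \<Longrightarrow> lab x \<noteq> 0 \<and> lab (antipode x) = - lab x"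
  shows "weight (alternating_count True lab p) (chain_map p antipode c) =
    weight (alternating_count False lab p) c"
  using assms(1) unfolding singular_chain_def
proof (induction c rule: frag_induction)
  case (one f)
  then have "f (\<lambda>i. if i = j then 1 else 0) \<in> topspace (nsphere m)" if "j \<le> p" for j
    using that by (auto simp: singular_simplex_def continuous_map_def Pi_iff)
  then have lab: "vertex_label lab (simplex_map p antipode f) j = - vertex_label lab f j"
      "vertex_label lab f j \<noteq> 0" if "j \<le> p" for j
    using that assms(2) by (simp_all add: vertex_label_def simplex_map_def)
  then have "vertex_label lab (simplex_map p antipode f) ` {..p} = uminus ` vertex_label lab f ` {..p}"
    unfolding image_image by (intro image_cong) auto
  moreover have "0 \<notin> vertex_label lab f ` {..p}"
    using lab(2) by auto
  ultimately show ?case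
    by (simp add: alternating_count_def alternating_labels_def alternating_uminus_iff card_image)
qed (simp_all add: chain_map_diff weight_diff)

text \<open>A form of Tucker's lemma: members of an open cover replace the edges of a symmetric
  triangulation. The signs in the boundary relation do not matter modulo 2, so the parity of
  \<open>N True k + N False k\<close> passes from \<open>k\<close> to \<open>Suc k\<close>.\<close>

lemma antipodal_labelling_complementary:
  assumes lab: "\<And>x. x \<in> topspace (nsphere m) \<Longrightarrow> lab (antipode x) = - lab x"
    "\<And>x. x \<in> topspace (nsphere m) \<Longrightarrow> lab x \<noteq> 0 \<and> \<bar>lab x\<bar> \<le> int m"
    and \<C>: "\<And>U. U \<in> \<C> \<Longrightarrow> openin (nsphere m) U" "topspace (nsphere m) \<subseteq> \<Union>\<C>"
  shows "\<exists>U\<in>\<C>. \<exists>x\<in>U. \<exists>y\<in>U. lab x = - lab y"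
proof (rule ccontr)
  assume no: "\<not> ?thesis"
  obtain c where c: "c 0 = base_chain" "\<And>k. k \<le> m \<Longrightarrow> singular_chain k (nsphere m) (c k)"
    "\<And>k. k < m \<Longrightarrow> chain_boundary (Suc k) (c (Suc k)) =
      chain_map k antipode (c k) + frag_cmul ((-1) ^ Suc k) (c k)"
    "\<And>k f. k \<le> m \<Longrightarrow> f \<in> Poly_Mapping.keys (c k) \<Longrightarrow> \<exists>U\<in>\<C>. f \<in> standard_simplex k \<rightarrow> U"
    using small_antipodal_chains[OF \<C>] by blast
  define N where "N b k = weight (alternating_count b lab k) (c k)" for b k
  \<comment> \<open>All vertices of a simplex lie in one member of the cover.\<close>
  have compl: "vertex_label lab f i \<noteq> - vertex_label lab f j"
    if kf: "k \<le> m" "f \<in> Poly_Mapping.keys (c k)" "i \<le> k" "j \<le> k" for k f i j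
  proof -
    obtain U where "U \<in> \<C>" "f \<in> standard_simplex k \<rightarrow> U"
      using c(4)[OF kf(1,2)] by blast
    then show ?thesis
      using no kf unfolding vertex_label_def Pi_iff by (metis basis_in_standard_simplex)
  qed
  have "odd (N True k + N False k)" if "k \<le> m" for k
    using that
  proof (induction k)
    case 0
    have "(\<lambda>i. if i = 0 then 1 else 0) \<in> topspace (nsphere m)"
      by (rule in_topspace_nsphere)
    then have "lab (\<lambda>i. if i = 0 then 1 else 0) \<noteq> 0"
      using lab(2) by blast
    \<comment> \<open>A single label alternates in exactly one of the two senses.\<close>
    moreover have "alternating b {x} \<longleftrightarrow> (x > 0 \<longleftrightarrow> b)" for b x
      using alternating_insert_iff[of "{}" x b] by simp
    ultimately show ?case
      by (auto simp: N_def c(1) base_chain_def alternating_count_def alternating_labels_def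
          vertex_label_def)
  next
    case (Suc k)
    have "weight (alternating_count True lab k) (chain_boundary (Suc k) (c (Suc k))) =
        N False k + (-1) ^ Suc k * N True k"
      using c(3)[of k] Suc.prems weight_chain_map_antipode[OF c(2)[of k], of lab] lab
      by (simp add: N_def weight_add weight_cmul weight_diff)
    moreover have "even (weight (alternating_count True lab k) (chain_boundary (Suc k) (c (Suc k)))
        - (N True (Suc k) + N False (Suc k)))"
      unfolding N_def using compl Suc.prems by (intro even_weight_boundary) blast
    moreover have "odd (N False k + (-1) ^ Suc k * N True k)"
      using Suc by (cases "even k") auto
    ultimately show ?case
      by simp
  qed
  then have "odd (N True m + N False m)"
    by simp
  moreover have "N b m = 0" for b
    unfolding N_def
  proof (rule weight_eq_0)
    fix f assume f: "f \<in> Poly_Mapping.keys (c m)"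
    let ?L = "vertex_label lab f ` {..m}"
    have "f (\<lambda>i. if i = j then 1 else 0) \<in> topspace (nsphere m)" if "j \<le> m" for j
      using that f c(2)[of m]
      by (auto simp: singular_chain_def singular_simplex_def continuous_map_def Pi_iff)
    then have "abs ` ?L \<subseteq> {1..int m}"
      using lab(2) by (force simp: vertex_label_def)
    then have "card (abs ` ?L) \<le> m"
      using card_mono[of "{1..int m}" "abs ` ?L"] by simp
    \<comment> \<open>Distinct labels of equal absolute value would be complementary.\<close>
    moreover have "inj_on abs ?L"
      using compl[OF _ f] by (auto simp: inj_on_def abs_eq_iff)
    ultimately have "card ?L \<le> m"
      by (simp add: card_image)
    then show "alternating_count b lab m f = 0"
      by (simp add: alternating_count_def alternating_labels_def)
  qed
  ultimately show False
    by simp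
qed

theorem Borsuk_Ulam:
  fixes F :: "nat \<Rightarrow> (nat \<Rightarrow> real) \<Rightarrow> real"
  assumes cont: "\<And>i. i < m \<Longrightarrow> continuous_map (nsphere m) euclideanreal (F i)"
    and odd: "\<And>i x. i < m \<Longrightarrow> x \<in> topspace (nsphere m) \<Longrightarrow> F i (antipode x) = - F i x"
  shows "\<exists>x\<in>topspace (nsphere m). \<forall>i<m. F i x = 0"
proof (rule ccontr)
  assume no: "\<not> ?thesis"
  let ?S = "nsphere m"
  define dominant where "dominant x i \<longleftrightarrow> i < m \<and> (\<forall>j<m. \<bar>F j x\<bar> \<le> \<bar>F i x\<bar>)" for x i
  \<comment> \<open>The least choice depends only on absolute values, so it is invariant under
    \<open>antipode\<close>.\<close>
  define ind where "ind x = (LEAST i. dominant x i)" for x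
  \<comment> \<open>\<open>Suc\<close> keeps the label of coordinate 0 nonzero, so that it has a
    sign.\<close>
  define lab where "lab x = (if F (ind x) x > 0 then int (Suc (ind x)) else - int (Suc (ind x)))" for x
  have dominant: "dominant x (ind x)" if "x \<in> topspace ?S" for x
  proof -
    \<comment> \<open>For \<open>m = 0\<close> the claim would hold vacuously at
      \<open>x\<close>.\<close>
    have "{..<m} \<noteq> {}"
      using no that by auto
    then have "Max ((\<lambda>j. \<bar>F j x\<bar>) ` {..<m}) \<in> (\<lambda>j. \<bar>F j x\<bar>) ` {..<m}"
      by (intro Max_in) auto
    then obtain i where i: "i < m" "Max ((\<lambda>j. \<bar>F j x\<bar>) ` {..<m}) = \<bar>F i x\<bar>"
      by auto
    have "\<bar>F j x\<bar> \<le> Max ((\<lambda>j. \<bar>F j x\<bar>) ` {..<m})" if "j < m" for j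
      using that by (intro Max_ge) auto
    with i have "dominant x i"
      by (simp add: dominant_def)
    then show ?thesis
      unfolding ind_def by (rule LeastI)
  qed
  have nonzero: "F (ind x) x \<noteq> 0" if x: "x \<in> topspace ?S" for x
  proof
    assume "F (ind x) x = 0"
    then have "\<forall>i<m. F i x = 0"
      using dominant[OF x] by (simp add: dominant_def)
    then show False
      using no x by blast
  qed
  have "dominant (antipode x) = dominant x" if "x \<in> topspace ?S" for x
    using odd[OF _ that] by (auto simp: dominant_def fun_eq_iff)
  then have ind_antipode: "ind (antipode x) = ind x" if "x \<in> topspace ?S" for x
    using that by (simp add: ind_def)
  \<comment> \<open>The radius is a third of the dominant value at \<open>y\<close>, so each
    \<open>F j\<close> varies by less than two thirds of it on a set of the cover.\<close>
  define \<C> where "\<C> = {{x \<in> topspace ?S. \<forall>j<m. \<bar>F j x - F j y\<bar> < \<bar>F (ind y) y\<bar> / 3} | y. y \<in> topspace ?S}"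
  have "\<exists>U\<in>\<C>. \<exists>x\<in>U. \<exists>y\<in>U. lab x = - lab y"
  proof (rule antipodal_labelling_complementary)
    show "lab (antipode x) = - lab x" if "x \<in> topspace ?S" for x
      using that ind_antipode odd nonzero dominant[OF that]
      by (auto simp: lab_def dominant_def not_less less_le)
    show "lab x \<noteq> 0 \<and> \<bar>lab x\<bar> \<le> int m" if "x \<in> topspace ?S" for x
      using dominant[OF that] by (auto simp: lab_def dominant_def)
    show "topspace ?S \<subseteq> \<Union>\<C>"
    proof
      fix y assume y: "y \<in> topspace ?S"
      let ?U = "{x \<in> topspace ?S. \<forall>j<m. \<bar>F j x - F j y\<bar> < \<bar>F (ind y) y\<bar> / 3}"
      have "y \<in> ?U" "?U \<in> \<C>"
        using y nonzero[OF y] unfolding \<C>_def by auto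
      then show "y \<in> \<Union>\<C>"
        by (rule UnionI[rotated])
    qed
    fix U assume "U \<in> \<C>"
    then obtain y where "U = {x \<in> topspace ?S. \<forall>j<m. \<bar>F j x - F j y\<bar> < \<bar>F (ind y) y\<bar> / 3}"
      by (auto simp: \<C>_def)
    then have "U = topspace ?S \<inter> (\<Inter>j\<in>{..<m}. {x \<in> topspace ?S. \<bar>F j x - F j y\<bar> < \<bar>F (ind y) y\<bar> / 3})"
      by auto
    moreover have "openin ?S {x \<in> topspace ?S. \<bar>F j x - F j y\<bar> < \<bar>F (ind y) y\<bar> / 3}" if "j < m" for j
    proof -
      have "continuous_map ?S euclideanreal (\<lambda>x. \<bar>F j x - F j y\<bar>)"
        using cont[OF that] by (intro continuous_intros) auto
      then have "openin ?S {x \<in> topspace ?S. \<bar>F j x - F j y\<bar> \<in> {..<\<bar>F (ind y) y\<bar> / 3}}"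
        by (rule openin_continuous_map_preimage) simp
      then show ?thesis by simp
    qed
    ultimately show "openin ?S U"
      by (cases "m = 0") (auto intro!: openin_Int openin_INT)
  qed
  then obtain y u v where y: "y \<in> topspace ?S" and uv: "u \<in> topspace ?S" "v \<in> topspace ?S"
    and near: "\<forall>j<m. \<bar>F j u - F j y\<bar> < \<bar>F (ind y) y\<bar> / 3" "\<forall>j<m. \<bar>F j v - F j y\<bar> < \<bar>F (ind y) y\<bar> / 3"
    and compl: "lab u = - lab v"
    by (auto simp: \<C>_def)
  have "ind u = ind v" and sgn: "F (ind u) u > 0 \<longleftrightarrow> \<not> F (ind v) v > 0"
    using compl by (auto simp: lab_def split: if_splits)
  then have "ind u < m" "ind y < m"
    and large: "\<bar>F (ind y) u\<bar> \<le> \<bar>F (ind u) u\<bar>" "\<bar>F (ind y) v\<bar> \<le> \<bar>F (ind u) v\<bar>"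
    using dominant[OF uv(1)] dominant[OF uv(2)] dominant[OF y] by (simp_all add: dominant_def)
  then have "\<bar>F (ind u) u - F (ind u) y\<bar> < \<bar>F (ind y) y\<bar> / 3"
      "\<bar>F (ind u) v - F (ind u) y\<bar> < \<bar>F (ind y) y\<bar> / 3"
      "\<bar>F (ind y) u - F (ind y) y\<bar> < \<bar>F (ind y) y\<bar> / 3"
      "\<bar>F (ind y) v - F (ind y) y\<bar> < \<bar>F (ind y) y\<bar> / 3"
    using near by simp_all
  \<comment> \<open>At \<open>u\<close> and \<open>v\<close> the coordinate \<open>ind u\<close>
    exceeds two thirds of the dominant value at \<open>y\<close> in absolute value, with opposite
    signs, yet its two values differ by less than two thirds of it.\<close>
  then show False
    using large sgn unfolding \<open>ind u = ind v\<close> by linarith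
qed

subsection \<open>The deleted join\<close>

text \<open>
  Let \<open>a + b + c = 0\<close>. At most one of the three cyclic excesses is positive, and they are not all
  zero for both \<open>(a, b, c)\<close> and \<open>(-a, -b, -c)\<close> unless \<open>a = b = c = 0\<close>. They thus map the plane
  \<open>a + b + c = 0\<close> to the cone over the hexagon, the deleted join of three points.
\<close>

definition excess :: "real \<Rightarrow> real \<Rightarrow> real \<Rightarrow> real" where
  "excess a b c = max 0 (a - max 0 (max b c))"

lemma excess_nonneg: "excess a b c \<ge> 0"
  by (simp add: excess_def)

lemma excess_eq: "0 \<le> a \<Longrightarrow> b \<le> 0 \<Longrightarrow> c \<le> 0 \<Longrightarrow> excess a b c = a"
  by (simp add: excess_def)

text \<open>One of the three numbers is opposed in sign to the other two. Up to negating all three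
  it is the nonnegative one, and its excess is its absolute value, the largest of the three.\<close>

lemma abs_le_sum_excess:
  assumes "a + b + c = 0"
  shows "\<bar>a\<bar> \<le> excess a b c + excess b c a + excess c a b
    + (excess (- a) (- b) (- c) + excess (- b) (- c) (- a) + excess (- c) (- a) (- b))"
proof -
  note nonneg = excess_nonneg[of a b c] excess_nonneg[of b c a] excess_nonneg[of c a b]
    excess_nonneg[of "- a" "- b" "- c"] excess_nonneg[of "- b" "- c" "- a"]
    excess_nonneg[of "- c" "- a" "- b"]
  consider "0 \<le> a" "b \<le> 0" "c \<le> 0" | "0 \<le> b" "c \<le> 0" "a \<le> 0" | "0 \<le> c" "a \<le> 0" "b \<le> 0"
    | "a \<le> 0" "0 \<le> b" "0 \<le> c" | "b \<le> 0" "0 \<le> c" "0 \<le> a" | "c \<le> 0" "0 \<le> a" "0 \<le> b"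
    using assms by argo
  then show ?thesis
  proof cases
    case 1
    then show ?thesis using nonneg excess_eq[of a b c] by linarith
  next
    case 2
    then show ?thesis using nonneg excess_eq[of b c a] assms by linarith
  next
    case 3
    then show ?thesis using nonneg excess_eq[of c a b] assms by linarith
  next
    case 4
    then show ?thesis using nonneg excess_eq[of "- a" "- b" "- c"] by linarith
  next
    case 5
    then show ?thesis using nonneg excess_eq[of "- b" "- c" "- a"] assms by linarith
  next
    case 6
    then show ?thesis using nonneg excess_eq[of "- c" "- a" "- b"] assms by linarith
  qed
qed

section \<open>Coordinates on three vertices of each block\<close>

fun block_of :: "nat \<Rightarrow> vertex \<Rightarrow> nat" where
  "block_of r (V i j) = i"
| "block_of r (W j) = r"

fun index_of :: "vertex \<Rightarrow> nat" where
  "index_of (V i j) = j"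
| "index_of (W j) = j"

text \<open>Block \<open>i\<close> owns the coordinates \<open>2 * (i - 1)\<close> and
  \<open>2 * (i - 1) + 1\<close>, which parametrize the plane of triples with sum zero. The
  \<open>r\<close> planes together make up the space of dimension \<open>2 * r\<close> around the
  sphere.\<close>

definition linear_form :: "nat \<Rightarrow> nat \<Rightarrow> (nat \<Rightarrow> real) \<Rightarrow> real" where
  "linear_form i j z = (if j = 1 then z (2 * (i - 1)) else if j = 2 then z (2 * (i - 1) + 1)
    else - z (2 * (i - 1)) - z (2 * (i - 1) + 1))"

definition next3 :: "nat \<Rightarrow> nat" where
  "next3 j = (if j = 1 then 2 else if j = 2 then 3 else 1)"

text \<open>Unnormalized barycentric coordinates of the first of two disjoint faces; the coordinates
  at \<open>antipode z\<close> give the second. They live on the first three vertices of each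
  block.\<close>

definition coord :: "nat \<Rightarrow> (nat \<Rightarrow> real) \<Rightarrow> vertex \<Rightarrow> real" where
  "coord r z v = (if v \<in> ground r \<and> index_of v \<le> 3 then
     excess (linear_form (block_of r v) (index_of v) z)
       (linear_form (block_of r v) (next3 (index_of v)) z)
       (linear_form (block_of r v) (next3 (next3 (index_of v))) z) else 0)"


definition coord_support :: "nat \<Rightarrow> (nat \<Rightarrow> real) \<Rightarrow> vertex set" where
  "coord_support r z = {v. coord r z v \<noteq> 0}"

lemma index_of_ground: "v \<in> ground r \<Longrightarrow> 1 \<le> index_of v"
  by (auto simp: ground_def block_def split: if_splits)

lemma block_of_block: "v \<in> block r i \<Longrightarrow> block_of r v = i"
  by (auto simp: block_def split: if_splits)

text \<open>\<open>V r j\<close> and \<open>W j\<close> agree in block and index, but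
  \<open>V r j\<close> lies outside \<open>ground r\<close>.\<close>

lemma ground_eqI:
  assumes "v \<in> ground r" "w \<in> ground r" "block_of r v = block_of r w" "index_of v = index_of w"
  shows "v = w"
  using assms by (auto simp: ground_def block_def split: if_splits)

lemma finite_ground: "finite (ground r)"
  by (auto simp: ground_def block_def)

lemma coord_nonneg: "coord r z v \<ge> 0"
  by (simp add: coord_def excess_nonneg)

lemma coord_support_ground: "coord_support r z \<subseteq> ground r"
  by (auto simp: coord_support_def coord_def)

text \<open>A positive excess singles out a positive strict maximum among the three forms of a
  block.\<close>

lemma coord_nonzeroD:
  assumes "coord r z v \<noteq> 0"
  shows "v \<in> ground r" "index_of v \<in> {1, 2, 3}" "linear_form (block_of r v) (index_of v) z > 0"
    "\<And>k. k \<in> {1, 2, 3} \<Longrightarrow> k \<noteq> index_of v \<Longrightarrow>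
      linear_form (block_of r v) k z < linear_form (block_of r v) (index_of v) z"
proof -
  let ?j = "index_of v"
  show v: "v \<in> ground r"
    using assms by (auto simp: coord_def split: if_splits)
  have "?j \<le> 3"
    using assms by (auto simp: coord_def split: if_splits)
  then show j: "?j \<in> {1, 2, 3}"
    using index_of_ground[OF v] by auto
  have "excess (linear_form (block_of r v) ?j z) (linear_form (block_of r v) (next3 ?j) z)
      (linear_form (block_of r v) (next3 (next3 ?j)) z) \<noteq> 0"
    using assms by (auto simp: coord_def split: if_splits)
  then have pos: "linear_form (block_of r v) ?j z > 0"
      "linear_form (block_of r v) (next3 ?j) z < linear_form (block_of r v) ?j z"
      "linear_form (block_of r v) (next3 (next3 ?j)) z < linear_form (block_of r v) ?j z"
    by (auto simp: excess_def max_def split: if_splits)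
  then show "linear_form (block_of r v) ?j z > 0"
    by blast
  show "linear_form (block_of r v) k z < linear_form (block_of r v) ?j z"
    if "k \<in> {1, 2, 3}" "k \<noteq> ?j" for k
  proof -
    have "k = next3 ?j \<or> k = next3 (next3 ?j)"
      using that j by (auto simp: next3_def)
    then show ?thesis
      using pos by blast
  qed
qed

lemma linear_form_antipode: "linear_form i j (antipode z) = - linear_form i j z"
  by (simp add: linear_form_def antipode_def)

text \<open>Vertices of a support have a positive form, and \<open>antipode\<close> negates all
  forms.\<close>

lemma coord_support_disjoint: "coord_support r z \<inter> coord_support r (antipode z) = {}"
proof -
  have "linear_form (block_of r v) (index_of v) z > 0 \<Longrightarrow>
      \<not> linear_form (block_of r v) (index_of v) (antipode z) > 0" for v
    by (simp add: linear_form_antipode)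
  then show ?thesis
    using coord_nonzeroD(3) unfolding coord_support_def by blast
qed

text \<open>Two vertices of the support in one block would each have the strictly larger
  form.\<close>

lemma coord_support_block:
  "card (coord_support r z \<inter> block r i) \<le> 1"
proof -
  have "v = w" if "v \<in> coord_support r z \<inter> block r i" "w \<in> coord_support r z \<inter> block r i" for v w
  proof -
    have nz: "coord r z v \<noteq> 0" "coord r z w \<noteq> 0" and eq: "block_of r v = block_of r w"
      using that block_of_block by (auto simp: coord_support_def)
    have "index_of v = index_of w"
      using coord_nonzeroD(2,4)[OF nz(1)] coord_nonzeroD(2,4)[OF nz(2)] eq
      by (metis less_asym)
    then show ?thesis
      using ground_eqI coord_nonzeroD(1) nz eq by blast
  qed
  then show ?thesis
    by (metis One_nat_def card.infinite card_le_Suc0_iff_eq zero_le)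
qed

text \<open>At most one vertex in each of the \<open>r\<close> blocks, the last included, gives the
  bound \<open>r\<close> on the size.\<close>

lemma coord_support_in_M: "coord_support r z \<in> M r"
proof -
  have "coord_support r z = (\<Union>i\<in>{1..r}. coord_support r z \<inter> block r i)"
    using coord_support_ground[of r z] by (auto simp: ground_def)
  then have "card (coord_support r z) \<le> (\<Sum>i\<in>{1..r}. card (coord_support r z \<inter> block r i))"
    using card_UN_le[of "{1..r}" "\<lambda>i. coord_support r z \<inter> block r i"] by simp
  also have "\<dots> \<le> (\<Sum>i\<in>{1..r}. 1)"
    using coord_support_block by (intro sum_mono) blast
  finally have "card (coord_support r z) \<le> r"
    by simp
  then show ?thesis
    using coord_support_ground coord_support_block by (simp add: M_def)
qed

section \<open>Normalization to points of the realization\<close>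

definition total_coord :: "nat \<Rightarrow> (nat \<Rightarrow> real) \<Rightarrow> real" where
  "total_coord r z = (\<Sum>v\<in>ground r. coord r z v)"

lemma abs_le_total_coord:
  assumes "r \<ge> 3" "k < 2 * r"
  shows "\<bar>z k\<bar> \<le> total_coord r z + total_coord r (antipode z)"
proof -
  \<comment> \<open>Coordinate \<open>k\<close> belongs to block \<open>i\<close>, counted from 1,
    and \<open>w j\<close> is the \<open>j\<close>-th vertex of that block; \<open>r \<ge> 3\<close>
    provides three of them.\<close>
  define i where "i = k div 2 + 1"
  define w where "w j = (if i = r then W j else V i j)" for j
  define l where "l j = linear_form i j z" for j
  have i: "1 \<le> i" "i \<le> r"
    using assms by (auto simp: i_def)
  have w: "w j \<in> ground r" if "j \<in> {1, 2, 3}" for j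
    using that i assms(1) by (auto simp: w_def ground_def block_def intro!: bexI[of _ i])
  have w_index: "index_of (w j) = j" "block_of r (w j) = i" for j
    by (auto simp: w_def)
  have "inj w"
    using w_index(1) by (metis injI)
  have part: "coord r x (w 1) + coord r x (w 2) + coord r x (w 3) \<le> total_coord r x" for x
  proof -
    have "coord r x (w 1) + coord r x (w 2) + coord r x (w 3) = (\<Sum>v\<in>w ` {1, 2, 3}. coord r x v)"
      using inj_eq[OF \<open>inj w\<close>] by simp
    also have "\<dots> \<le> total_coord r x"
      unfolding total_coord_def using w finite_ground coord_nonneg by (intro sum_mono2) auto
    finally show ?thesis .
  qed
  have coords: "coord r z (w 1) = excess (l 1) (l 2) (l 3)" "coord r z (w 2) = excess (l 2) (l 3) (l 1)"
      "coord r z (w 3) = excess (l 3) (l 1) (l 2)"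
      "coord r (antipode z) (w 1) = excess (- l 1) (- l 2) (- l 3)"
      "coord r (antipode z) (w 2) = excess (- l 2) (- l 3) (- l 1)"
      "coord r (antipode z) (w 3) = excess (- l 3) (- l 1) (- l 2)"
    using w by (simp_all add: coord_def w_index next3_def l_def linear_form_antipode)
  \<comment> \<open>Two cyclic rotations, since \<open>z k\<close> is the first or the second
    form.\<close>
  have "l 1 + l 2 + l 3 = 0" "l 2 + l 3 + l 1 = 0"
    by (simp_all add: l_def linear_form_def)
  note abs_le_sum_excess[OF this(1)] abs_le_sum_excess[OF this(2)]
  moreover have "z k = l 1 \<or> z k = l 2"
    by (cases "even k") (auto simp: l_def linear_form_def i_def elim!: evenE oddE)
  ultimately show ?thesis
    using part[of z] part[of "antipode z"] unfolding coords by auto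
qed

text \<open>Otherwise all \<open>2 * r\<close> coordinates would be below
  \<open>1 / (2 * r) \<le> 1\<close> in absolute value, and their squares would sum to less than
  1.\<close>

lemma total_coord_lower_bound:
  assumes "r \<ge> 3" "z \<in> topspace (nsphere (2 * r - 1))"
  shows "total_coord r z + total_coord r (antipode z) \<ge> 1 / (2 * r)"
proof (rule ccontr)
  let ?t = "total_coord r z + total_coord r (antipode z)"
  assume "\<not> ?thesis"
  then have t: "?t < 1 / (2 * r)"
    by simp
  have "1 / (2 * real r) \<le> 1"
    using assms(1) by simp
  have "(\<Sum>k\<le>2 * r - 1. (z k)\<^sup>2) \<le> (\<Sum>k\<le>2 * r - 1. ?t)"
  proof (rule sum_mono)
    fix k assume "k \<in> {..2 * r - 1}"
    then have "\<bar>z k\<bar> \<le> ?t"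
      using assms(1) by (intro abs_le_total_coord) auto
    moreover from this have "\<bar>z k\<bar> * \<bar>z k\<bar> \<le> \<bar>z k\<bar> * 1"
      using t \<open>1 / (2 * real r) \<le> 1\<close> by (intro mult_left_mono) auto
    ultimately show "(z k)\<^sup>2 \<le> ?t"
      by (simp add: power2_eq_square abs_mult[symmetric])
  qed
  also have "\<dots> = 2 * real r * ?t"
    using assms(1) by simp
  also have "\<dots> < 1"
    using t assms(1) by (simp add: field_simps)
  finally show False
    using assms(2) by (simp add: nsphere)
qed

lemma continuous_on_coordinate: "continuous_on S (\<lambda>x. x i)"
  by (rule continuous_on_subset[OF continuous_on_product_coordinates subset_UNIV])

lemma continuous_on_coord: "continuous_on S (\<lambda>z. coord r z v)"
proof -
  have "continuous_on S (\<lambda>z. linear_form i j z)" for i j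
    unfolding linear_form_def
    by (cases "j = 1"; cases "j = 2") (auto intro!: continuous_intros continuous_on_coordinate)
  then show ?thesis
    unfolding coord_def excess_def
    by (cases "v \<in> ground r \<and> index_of v \<le> 3") (auto intro!: continuous_intros)
qed

lemma continuous_on_total_coord: "continuous_on S (total_coord r)"
  unfolding total_coord_def by (intro continuous_on_sum continuous_on_coord)

text \<open>Where the total is zero this is the zero function, which is outside the
  realization.\<close>

definition coord_point :: "nat \<Rightarrow> (nat \<Rightarrow> real) \<Rightarrow> vertex \<Rightarrow> real" where
  "coord_point r z = (\<lambda>v. coord r z v / total_coord r z)"

lemma coord_point_in_face:
  assumes "total_coord r z > 0"
  shows "coord_point r z \<in> face_realization (coord_support r z)"
proof -
  have "(\<Sum>v\<in>coord_support r z. coord r z v) = total_coord r z"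
    unfolding total_coord_def using coord_support_ground finite_ground
    by (intro sum.mono_neutral_left) (auto simp: coord_support_def)
  then show ?thesis
    using assms coord_nonneg
    by (auto simp: face_realization_def coord_point_def coord_support_def sum_divide_distrib[symmetric])
qed

lemma coord_point_in_realization: "total_coord r z > 0 \<Longrightarrow> coord_point r z \<in> realization (M r)"
  using coord_point_in_face coord_support_in_M unfolding realization_def by blast

lemma continuous_on_coord_point:
  assumes "\<And>z. z \<in> S \<Longrightarrow> total_coord r z > 0"
  shows "continuous_on S (coord_point r)"
  unfolding coord_point_def
  by (rule continuous_on_coordinatewise_then_product)
    (use assms in \<open>force intro!: continuous_intros continuous_on_coord continuous_on_total_coord\<close>)

lemma continuous_on_antipode: "continuous_on S antipode"
  unfolding antipode_def
  by (intro continuous_on_coordinatewise_then_product continuous_intros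
      continuous_on_coordinate)

text \<open>Borsuk--Ulam is applied to \<open>2 * r - 1\<close> functions \<open>F k\<close>: the
  first \<open>d\<close> compare the images of the two points, the others compare the totals. As
  \<open>d \<le> 2 * r - 2\<close>, at least one of the latter exists, so at a common zero both
  points carry equal weight.\<close>

lemma M_two_disjoint_faces:
  assumes "r \<ge> 3" "d \<le> 2 * r - 2"
    and f: "continuous_map (realization_topology (M r)) (Euclidean_space d) f"
  obtains \<sigma> \<tau> where "\<sigma> \<in> M r" "\<tau> \<in> M r" "\<sigma> \<inter> \<tau> = {}"
    "f ` face_realization \<sigma> \<inter> f ` face_realization \<tau> \<noteq> {}"
proof -
  let ?m = "2 * r - 1" and ?p = "coord_point r" and ?t = "total_coord r"
  let ?S = "topspace (nsphere ?m)"
  \<comment> \<open>Cutting off at \<open>\<delta>\<close> keeps \<open>F\<close> continuous where one of the normalizing totals vanishes.\<close>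
  define \<delta> where "\<delta> = 1 / (8 * real r)"
  have \<delta>: "\<delta> > 0"
    using assms(1) by (simp add: \<delta>_def)
  \<comment> \<open>Symmetric under \<open>antipode\<close>, so the factor
    \<open>s z - \<delta>\<close> is even and keeps \<open>F\<close> odd.\<close>
  define s where "s z = min (?t z) (?t (antipode z))" for z
  define F where "F k z = (if k < d then (if s z \<le> \<delta> then 0
      else (s z - \<delta>) * (f (?p z) k - f (?p (antipode z)) k)) else ?t z - ?t (antipode z))" for k z
  have cont_t: "continuous_on T (\<lambda>z. ?t (antipode z))" for T
    by (rule continuous_on_compose2[OF continuous_on_total_coord continuous_on_antipode subset_UNIV])
  have cont_s: "continuous_on T s" for T
    unfolding s_def by (intro continuous_intros continuous_on_total_coord cont_t)
  have f_cont: "continuous_on (realization (M r)) (\<lambda>x. f x k)" for k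
  proof -
    have "continuous_map (realization_topology (M r)) (powertop_real UNIV) f"
      using f by (simp add: Euclidean_space_def continuous_map_in_subtopology)
    then have "continuous_map (realization_topology (M r)) euclideanreal (\<lambda>x. f x k)"
      by (simp add: continuous_map_componentwise_UNIV)
    then show ?thesis
      by (simp add: realization_topology_def euclidean_product_topology)
  qed
  have cont_F: "continuous_on T (F k)" for k T
  proof (cases "k < d")
    case True
    let ?T = "{z \<in> T. \<delta> \<le> s z}"
    have pos: "?t z > 0" "?t (antipode z) > 0" if "z \<in> ?T" for z
      using that \<delta> by (auto simp: s_def)
    have "continuous_on ?T (\<lambda>z. f (?p z) k)"
      using pos coord_point_in_realization
      by (intro continuous_on_compose2[OF f_cont continuous_on_coord_point]) auto
    moreover have "continuous_on ?T (\<lambda>z. ?p (antipode z))"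
      using pos
      by (intro continuous_on_compose2[OF continuous_on_coord_point continuous_on_antipode, of "antipode ` ?T"])
        auto
    then have "continuous_on ?T (\<lambda>z. f (?p (antipode z)) k)"
      using pos coord_point_in_realization
      by (intro continuous_on_compose2[OF f_cont]) auto
    ultimately have "continuous_on ?T (\<lambda>z. (s z - \<delta>) * (f (?p z) k - f (?p (antipode z)) k))"
      by (intro continuous_intros cont_s)
    \<comment> \<open>The two branches agree where \<open>s z = \<delta>\<close>, because the factor
      vanishes there.\<close>
    then show ?thesis
      unfolding F_def using True
      by (simp, intro continuous_on_cases_le cont_s) (auto intro: continuous_intros)
  next
    case False
    then show ?thesis
      unfolding F_def by (auto intro!: continuous_intros continuous_on_total_coord cont_t)
  qed
  have "\<exists>z\<in>?S. \<forall>k<?m. F k z = 0"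
  proof (rule Borsuk_Ulam)
    show "continuous_map (nsphere ?m) euclideanreal (F k)" for k
      using cont_F[of "{x. (\<Sum>i\<le>?m. (x i)\<^sup>2) = 1 \<and> (\<forall>i>?m. x i = 0)}" k]
      by (simp add: nsphere euclidean_product_topology)
    show "F k (antipode z) = - F k z" for k z
      by (simp add: F_def s_def min.commute algebra_simps)
  qed
  then obtain z where z: "z \<in> ?S" "\<And>k. k < ?m \<Longrightarrow> F k z = 0"
    by blast
  have "d < ?m"
    using assms by simp
  then have eq: "?t z = ?t (antipode z)"
    using z(2)[of d] by (simp add: F_def)
  \<comment> \<open>The totals are equal with sum at least \<open>4 * \<delta>\<close>, so each is
    at least \<open>2 * \<delta>\<close> and the cutoff is inactive.\<close>
  have "?t z + ?t (antipode z) \<ge> 1 / (2 * real r)"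
    using total_coord_lower_bound[OF assms(1) z(1)] by simp
  moreover have "1 / (2 * real r) = 4 * \<delta>"
    by (simp add: \<delta>_def)
  ultimately have t: "?t z > 0" "?t (antipode z) > 0" "s z > \<delta>"
    using eq \<delta> by (auto simp: s_def)
  have "f (?p z) k = f (?p (antipode z)) k" for k
  proof (cases "k < d")
    case True
    then show ?thesis
      using z(2)[of k] t(3) \<open>d < ?m\<close> by (simp add: F_def)
  next
    case False
    \<comment> \<open>From index \<open>d\<close> on, all points of \<open>Euclidean_space d\<close>
      have coordinate 0.\<close>
    have "f x \<in> topspace (Euclidean_space d)" if "x \<in> realization (M r)" for x
      using f that by (auto simp: continuous_map_def realization_topology_def)
    then show ?thesis
      using False t coord_point_in_realization by (simp add: topspace_Euclidean_space)
  qed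
  then have "f (?p z) = f (?p (antipode z))"
    by blast
  then have "f ` face_realization (coord_support r z) \<inter>
      f ` face_realization (coord_support r (antipode z)) \<noteq> {}"
    using coord_point_in_face t by blast
  then show ?thesis
    using that coord_support_in_M coord_support_disjoint by blast
qed

text \<open>A constant map already forces the bound: the faces it yields are nonempty, and vertices
  chosen from disjoint faces are distinct.\<close>

lemma has_tverberg_property_le_card:
  fixes \<Sigma> :: "'a set set"
  assumes "has_tverberg_property \<Sigma> d k" "finite A" "\<Union>\<Sigma> \<subseteq> A"
  shows "k \<le> card A"
proof -
  let ?f = "\<lambda>(_ :: 'a \<Rightarrow> real) (_ :: nat). 0 :: real"
  have f: "continuous_map (realization_topology \<Sigma>) (Euclidean_space d) ?f"
    by (simp add: topspace_Euclidean_space)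
  obtain \<sigma> where \<sigma>: "\<forall>i\<in>{1..k}. \<sigma> i \<in> \<Sigma>"
      "\<forall>i\<in>{1..k}. \<forall>j\<in>{1..k}. i \<noteq> j \<longrightarrow> \<sigma> i \<inter> \<sigma> j = {}"
      "(\<Inter>i\<in>{1..k}. ?f ` face_realization (\<sigma> i)) \<noteq> {}"
    using assms(1)[unfolded has_tverberg_property_def, rule_format, OF f] by (elim exE conjE) (rule that)
  have x: "(SOME x. x \<in> \<sigma> i) \<in> \<sigma> i" (is "?x i \<in> _") if "i \<in> {1..k}" for i
  proof -
    have "face_realization (\<sigma> i) \<noteq> {}"
      using \<sigma>(3) that by blast
    then have "\<sigma> i \<noteq> {}"
      by (auto simp: face_realization_def)
    then show ?thesis
      by (simp add: some_in_eq)
  qed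
  have "inj_on ?x {1..k}"
  proof (rule inj_onI, rule ccontr)
    fix i j assume i: "i \<in> {1..k}" and j: "j \<in> {1..k}" and eq: "?x i = ?x j" and "i \<noteq> j"
    then have "\<sigma> i \<inter> \<sigma> j = {}"
      using \<sigma>(2) by blast
    then show False
      using x[OF i] x[OF j] unfolding eq by (metis disjoint_iff)
  qed
  moreover have "?x ` {1..k} \<subseteq> A"
  proof (rule image_subsetI)
    fix i assume i: "i \<in> {1..k}"
    then have "\<sigma> i \<subseteq> A"
      using \<sigma>(1) assms(3) by blast
    then show "?x i \<in> A"
      using x[OF i] by (rule subsetD)
  qed
  ultimately show ?thesis
    using card_inj_on_le[of ?x "{1..k}" A] assms(2) by simp
qed

theorem theorem1p3:
  fixes d r :: nat
  assumes "d \<ge> 1" and "r \<ge> 3" and "2 * r - 2 \<ge> d"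
  shows "TT (M r) d \<ge> 2 \<and>
    (\<forall>f. continuous_map (realization_topology (M r)) (Euclidean_space d) f \<longrightarrow>
       (\<exists>\<sigma>\<^sub>1\<in>M r. \<exists>\<sigma>\<^sub>2\<in>M r. \<sigma>\<^sub>1 \<inter> \<sigma>\<^sub>2 = {} \<and>
          f ` face_realization \<sigma>\<^sub>1 \<inter> f ` face_realization \<sigma>\<^sub>2 \<noteq> {}))"
proof
  show "\<forall>f. continuous_map (realization_topology (M r)) (Euclidean_space d) f \<longrightarrow>
       (\<exists>\<sigma>\<^sub>1\<in>M r. \<exists>\<sigma>\<^sub>2\<in>M r. \<sigma>\<^sub>1 \<inter> \<sigma>\<^sub>2 = {} \<and>
          f ` face_realization \<sigma>\<^sub>1 \<inter> f ` face_realization \<sigma>\<^sub>2 \<noteq> {})"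
  proof (intro allI impI)
    fix f assume "continuous_map (realization_topology (M r)) (Euclidean_space d) f"
    from M_two_disjoint_faces[OF assms(2,3) this] obtain \<sigma> \<tau> where
      "\<sigma> \<in> M r" "\<tau> \<in> M r" "\<sigma> \<inter> \<tau> = {}" "f ` face_realization \<sigma> \<inter> f ` face_realization \<tau> \<noteq> {}" .
    then show "\<exists>\<sigma>\<^sub>1\<in>M r. \<exists>\<sigma>\<^sub>2\<in>M r. \<sigma>\<^sub>1 \<inter> \<sigma>\<^sub>2 = {} \<and>
          f ` face_realization \<sigma>\<^sub>1 \<inter> f ` face_realization \<sigma>\<^sub>2 \<noteq> {}"
      by (intro bexI conjI)
  qed
  have "has_tverberg_property (M r) d 2"
    unfolding has_tverberg_property_def
  proof (intro allI impI)
    fix f assume "continuous_map (realization_topology (M r)) (Euclidean_space d) f"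
    from M_two_disjoint_faces[OF assms(2,3) this] obtain \<sigma> \<tau> where \<sigma>\<tau>:
      "\<sigma> \<in> M r" "\<tau> \<in> M r" "\<sigma> \<inter> \<tau> = {}" "f ` face_realization \<sigma> \<inter> f ` face_realization \<tau> \<noteq> {}" .
    have "{1..2} = {1, 2 :: nat}"
      by auto
    then show "\<exists>\<sigma>. (\<forall>i\<in>{1..2}. \<sigma> i \<in> M r) \<and>
        (\<forall>i\<in>{1..2}. \<forall>j\<in>{1..2}. i \<noteq> j \<longrightarrow> \<sigma> i \<inter> \<sigma> j = {}) \<and>
        (\<Inter>i\<in>{1..2 :: nat}. f ` face_realization (\<sigma> i)) \<noteq> {}"
      using \<sigma>\<tau> by (intro exI[of _ "\<lambda>i. if i = 1 then \<sigma> else \<tau>"]) (auto simp: Int_commute)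
  qed
  \<comment> \<open>Boundedness of the admissible \<open>k\<close> makes \<open>GREATEST\<close> a
    true maximum, hence at least the admissible value 2.\<close>
  moreover have "\<Union>(M r) \<subseteq> ground r"
    by (auto simp: M_def)
  then have "k \<le> card (ground r)" if "has_tverberg_property (M r) d k" for k
    using that has_tverberg_property_le_card finite_ground by metis
  ultimately show "TT (M r) d \<ge> 2"
    unfolding TT_def by (intro Greatest_le_nat[where b = "card (ground r)"]) auto
qed

end
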